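(* Let $X$ be a complete semimodule over a complete idempotent semiring $\mathbb{S}$, let $V$ be a complete subsemimodule of $X$, let $x\in X$ with $x\notin V$, and let $K:=\{h\in X\mid h\backslash x\leq h\backslash P_V(x)\}$ be the associated complete half-space separating $x$ and $V$ (that is, $V\subset K$ and $x\notin K$). Then $$d(x,V)=d(x,K).$$
   Context: A complete idempotent semiring $\mathbb{S}$ is a semiring with idempotent addition $\oplus$ such that, for the natural order ($\lambda\leq\mu\Leftrightarrow\lambda\oplus\mu=\mu$), every subset has a supremum and the multiplication $\otimes$ distributes over arbitrary suprema on both sides. A complete semimodule $X$ over $\mathbb{S}$ is a (right) semimodule with idempotent addition $\oplus$ and action $(x,\lambda)\mapsto x\lambda$, such that for the natural order ($x\leq y\Leftrightarrow x\oplus y=y$) every subset of $X$ has a supremum and the action distributes over arbitrary suprema in each argument. A complete subsemimodule of $X$ is a subset stable under arbitrary suprema and under the action of scalars. For $x,y\in X$, $x\backslash y:=\max\{\lambda\in\mathbb{S}\mid x\lambda\leq y\}$. For a complete subsemimodule $V$, $P_V(x):=\max\{v\in V\mid v\leq x\}$. Put $\delta(x,y):=(x\backslash y)\otimes(y\backslash x)\in\mathbb{S}$. Hilbert's projective distance is $d(x,y):=\delta(x,y)^{-}$, where $\lambda\mapsto\lambda^{-}$ is the order-reversing "opposite" map: for $\mathbb{S}=\overline{\mathbb{R}}_{\max}$ (the set $\mathbb{R}\cup\{-\infty,+\infty\}$ with $\oplus=\max$, $\otimes=+$ and $(-\infty)+(+\infty)=-\infty$) it is the usual $\lambda^{-}=-\lambda$;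 for a general $\mathbb{S}$ it is read as the identity map from $\mathbb{S}$ to $\mathbb{S}$ equipped with the reversed order. For $M\subset X$, $d(x,M):=\inf_{v\in M}d(x,v)$, equivalently $d(x,M)=\big(\sup_{v\in M}\delta(x,v)\big)^{-}$. *)

theory Defs
  imports Main "HOL-Library.Extended_Real" "HOL-Library.Dual_Ordered_Lattice"
begin

text \<open>
  The idempotent addition is the class operation \<open>+\<close>; the axiom \<open>le_iff_add_eq\<close> says that the
  class order is the natural order of \<open>+\<close>, and reflexivity then gives \<open>x + x = x\<close>.
  The bottom element \<open>Sup {}\<close> is \<open>0\<close>.
\<close>

class complete_idempotent_monoid_add = comm_monoid_add + complete_lattice +
  assumes le_iff_add_eq: "x \<le> y \<longleftrightarrow> x + y = y"

text \<open>
  Built on \<^class>\<open>semiring_0\<close> and \<^class>\<open>monoid_mult\<close> instead of \<^class>\<open>semiring_1\<close>, so that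
  \<open>0 \<noteq> 1\<close> is not imposed.
\<close>

class complete_idempotent_semiring =
  complete_idempotent_monoid_add + semiring_0 + monoid_mult +
  assumes mult_Sup_distrib: "x * Sup A = (SUP y\<in>A. x * y)"
    and Sup_mult_distrib: "Sup A * x = (SUP y\<in>A. y * x)"

locale complete_semimodule =
  fixes act :: "'x::complete_idempotent_monoid_add \<Rightarrow> 's::complete_idempotent_semiring \<Rightarrow> 'x"
  assumes act_mult: "act x (a * b) = act (act x a) b"
    and act_one: "act x 1 = x"
    and act_add_left: "act (x + y) a = act x a + act y a"
    and act_add_right: "act x (a + b) = act x a + act x b"
    and act_zero_left: "act 0 a = 0"
    and act_zero_right: "act x 0 = 0"
    and act_Sup_left: "act (Sup A) a = (SUP x\<in>A. act x a)"
    and act_Sup_right: "act x (Sup B) = (SUP a\<in>B. act x a)"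

definition complete_subsemimodule ::
    "('x::complete_idempotent_monoid_add \<Rightarrow> 's::complete_idempotent_semiring \<Rightarrow> 'x) \<Rightarrow> 'x set \<Rightarrow> bool"
  where "complete_subsemimodule act V \<longleftrightarrow>
    (\<forall>A. A \<subseteq> V \<longrightarrow> Sup A \<in> V) \<and> (\<forall>v\<in>V. \<forall>a. act v a \<in> V)"

definition residual ::
    "('x::complete_idempotent_monoid_add \<Rightarrow> 's::complete_idempotent_semiring \<Rightarrow> 'x) \<Rightarrow> 'x \<Rightarrow> 'x \<Rightarrow> 's"
  where "residual act x y = (GREATEST a. act x a \<le> y)"

definition proj :: "'x::complete_idempotent_monoid_add set \<Rightarrow> 'x \<Rightarrow> 'x"
  where "proj V x = (GREATEST v. v \<in> V \<and> v \<le> x)"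

definition hilbert_delta ::
    "('x::complete_idempotent_monoid_add \<Rightarrow> 's::complete_idempotent_semiring \<Rightarrow> 'x) \<Rightarrow> 'x \<Rightarrow> 'x \<Rightarrow> 's"
  where "hilbert_delta act x y = residual act x y * residual act y x"

text \<open>
  The opposite map from the semiring to its order dual is determined only up to the choice of
  a copy of that dual: in general it is \<^const>\<open>dual\<close>, the identity onto the reversed order, while
  over the completed max-plus semiring (ordered as \<^typ>\<open>ereal\<close>) it is negation.  Both are
  order-reversing bijections, and the distance is taken with respect to any such map.
\<close>

definition opposite_map :: "('s::order \<Rightarrow> 't::complete_lattice) \<Rightarrow> bool"
  where "opposite_map opp \<longleftrightarrow> bij opp \<and> (\<forall>a b. opp a \<le> opp b \<longleftrightarrow> b \<le> a)"

lemma opposite_map_dual: "opposite_map (dual :: 's::complete_lattice \<Rightarrow> 's dual)"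
  by (simp add: opposite_map_def bij_dual)

lemma opposite_map_uminus: "opposite_map (uminus :: ereal \<Rightarrow> ereal)"
proof -
  have "bij (uminus :: ereal \<Rightarrow> ereal)"
    by (rule o_bij[where g = uminus]) (simp_all add: fun_eq_iff)
  then show ?thesis
    by (simp add: opposite_map_def)
qed

definition hilbert_dist ::
    "('s::complete_idempotent_semiring \<Rightarrow> 't::complete_lattice) \<Rightarrow>
     ('x::complete_idempotent_monoid_add \<Rightarrow> 's \<Rightarrow> 'x) \<Rightarrow> 'x \<Rightarrow> 'x \<Rightarrow> 't"
  where "hilbert_dist opp act x y = opp (hilbert_delta act x y)"

definition hilbert_dist_set ::
    "('s::complete_idempotent_semiring \<Rightarrow> 't::complete_lattice) \<Rightarrow>
     ('x::complete_idempotent_monoid_add \<Rightarrow> 's \<Rightarrow> 'x) \<Rightarrow> 'x \<Rightarrow> 'x set \<Rightarrow> 't"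
  where "hilbert_dist_set opp act x M = (INF v\<in>M. hilbert_dist opp act x v)"

definition separating_half_space ::
    "('x::complete_idempotent_monoid_add \<Rightarrow> 's::complete_idempotent_semiring \<Rightarrow> 'x) \<Rightarrow> 'x set \<Rightarrow> 'x \<Rightarrow> 'x set"
  where "separating_half_space act V x = {h. residual act h x \<le> residual act h (proj V x)}"

end

theory Submission
  imports Defs
begin

text \<open>
  The projection \<open>P = proj V x\<close> attains both infima. For \<open>h\<close> in the half-space,
  \<open>(x\h) (h\x) \<le> (x\h) (h\P) \<le> x\P \<le> (x\P) (P\x)\<close>: the first inequality is membership in the
  half-space, and the last holds because \<open>P \<le> x\<close> gives \<open>1 \<le> P\x\<close>. Moreover \<open>P \<in> V\<close>, and \<open>V\<close> lies
  in the half-space.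
\<close>

lemma mult_left_mono_idempotent:
  fixes a b c :: "'s::complete_idempotent_semiring"
  assumes "a \<le> b"
  shows "c * a \<le> c * b"
  using assms by (simp add: le_iff_add_eq flip: distrib_left)

context complete_semimodule
begin

lemma act_mono_left: "x \<le> y \<Longrightarrow> act x a \<le> act y a"
  by (simp add: le_iff_add_eq flip: act_add_left)

lemma act_mono_right: "a \<le> b \<Longrightarrow> act x a \<le> act x b"
  by (simp add: le_iff_add_eq flip: act_add_right)

text \<open>Because \<open>act x\<close> preserves suprema of scalars, the supremum of the
  admissible scalars is itself admissible, so the maximum in \<open>residual\<close> is
  attained.\<close>

lemma residual_eq_Sup: "residual act x y = Sup {a. act x a \<le> y}"
  unfolding residual_def
  by (rule Greatest_equality) (auto simp: act_Sup_right intro: SUP_least Sup_upper)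

text \<open>Galois connection: \<open>residual act x\<close> is the right adjoint of
  \<open>act x\<close>. Later facts on residuals are derived from it.\<close>

lemma le_residual_iff: "a \<le> residual act x y \<longleftrightarrow> act x a \<le> y"
proof
  have "act x (residual act x y) \<le> y"
    by (auto simp: residual_eq_Sup act_Sup_right intro: SUP_least)
  moreover assume "a \<le> residual act x y"
  ultimately show "act x a \<le> y"
    using act_mono_right order_trans by blast
qed (simp add: residual_eq_Sup Sup_upper)

lemma act_residual_le: "act x (residual act x y) \<le> y"
  using le_residual_iff by blast

text \<open>The first factor moves \<open>x\<close> below \<open>y\<close>; by monotonicity of the
  action, the second then moves the result below \<open>z\<close>.\<close>

lemma residual_mult_le: "residual act x y * residual act y z \<le> residual act x z"
  unfolding le_residual_iff act_mult
  by (rule order_trans[OF act_mono_left[OF act_residual_le] act_residual_le])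

lemma one_le_residual: "x \<le> y \<Longrightarrow> 1 \<le> residual act x y"
  by (simp add: le_residual_iff act_one)

end

text \<open>Closure of \<open>V\<close> under suprema puts this supremum back into \<open>V\<close>,
  so it is the greatest element sought by \<open>proj\<close>.\<close>

lemma proj_eq_Sup:
  assumes "complete_subsemimodule act V"
  shows "proj V x = Sup {v \<in> V. v \<le> x}"
proof -
  have "Sup {v \<in> V. v \<le> x} \<in> V"
    using assms by (simp add: complete_subsemimodule_def)
  then show ?thesis
    unfolding proj_def by (intro Greatest_equality) (auto intro: Sup_least Sup_upper)
qed

lemma proj_mem: "complete_subsemimodule act V \<Longrightarrow> proj V x \<in> V"
  by (subst proj_eq_Sup) (auto simp: complete_subsemimodule_def)

lemma proj_le: "complete_subsemimodule act V \<Longrightarrow> proj V x \<le> x"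
  by (subst proj_eq_Sup) (auto intro: Sup_least)

lemma le_proj: "complete_subsemimodule act V \<Longrightarrow> v \<in> V \<Longrightarrow> v \<le> x \<Longrightarrow> v \<le> proj V x"
  by (subst proj_eq_Sup) (auto intro: Sup_upper)

context complete_semimodule
begin

text \<open>For \<open>v\<close> in \<open>V\<close>, the multiple of \<open>v\<close> by
  \<open>residual act v x\<close> stays in \<open>V\<close> and lies below \<open>x\<close>, hence
  below the projection; the adjunction turns this into membership.\<close>

lemma subset_separating_half_space:
  assumes V: "complete_subsemimodule act V"
  shows "V \<subseteq> separating_half_space act V x"
proof
  fix v assume "v \<in> V"
  then have "act v (residual act v x) \<in> V"
    using V by (simp add: complete_subsemimodule_def)
  then have "act v (residual act v x) \<le> proj V x"
    by (rule le_proj[OF V _ act_residual_le])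
  then show "v \<in> separating_half_space act V x"
    by (simp add: separating_half_space_def le_residual_iff)
qed

lemma hilbert_delta_le_proj:
  assumes V: "complete_subsemimodule act V" and h: "h \<in> separating_half_space act V x"
  shows "hilbert_delta act x h \<le> hilbert_delta act x (proj V x)"
proof -
  let ?P = "proj V x"
  have "hilbert_delta act x h \<le> residual act x h * residual act h ?P"
    using h by (simp add: hilbert_delta_def separating_half_space_def mult_left_mono_idempotent)
  also have "\<dots> \<le> residual act x ?P"
    by (rule residual_mult_le)
  also have "\<dots> \<le> residual act x ?P * residual act ?P x"
    using mult_left_mono_idempotent[OF one_le_residual[OF proj_le[OF V]]] by simp
  finally show ?thesis
    by (simp add: hilbert_delta_def)
qed

text \<open>Stated for any \<open>M\<close> between the singleton of the projection and the
  half-space, so that it covers both sides of the final equation.\<close>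

lemma hilbert_dist_set_eq_proj:
  assumes "opposite_map opp" and V: "complete_subsemimodule act V"
    and "proj V x \<in> M" and "M \<subseteq> separating_half_space act V x"
  shows "hilbert_dist_set opp act x M = hilbert_dist opp act x (proj V x)"
  unfolding hilbert_dist_set_def
proof (rule antisym)
  show "(INF v\<in>M. hilbert_dist opp act x v) \<le> hilbert_dist opp act x (proj V x)"
    using assms(3) by (rule INF_lower)
  \<comment> \<open>Since \<open>opp\<close> reverses the order, the largest
    \<open>hilbert_delta\<close> gives the smallest distance.\<close>
  show "hilbert_dist opp act x (proj V x) \<le> (INF v\<in>M. hilbert_dist opp act x v)"
    using assms by (intro INF_greatest)
      (auto simp: hilbert_dist_def opposite_map_def intro!: hilbert_delta_le_proj[OF V])
qed

end

theorem corollary4p2: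
  fixes act :: "'x::complete_idempotent_monoid_add \<Rightarrow> 's::complete_idempotent_semiring \<Rightarrow> 'x"
    and opp :: "'s \<Rightarrow> 't::complete_lattice"
    and V :: "'x set" and x :: 'x
  assumes "complete_semimodule act"
    and "opposite_map opp"
    and "complete_subsemimodule act V"
    and "x \<notin> V"
  shows "hilbert_dist_set opp act x V
    = hilbert_dist_set opp act x (separating_half_space act V x)"
proof -
  interpret complete_semimodule act
    by fact
  have "V \<subseteq> separating_half_space act V x" and "proj V x \<in> V"
    using assms(3) by (rule subset_separating_half_space, rule proj_mem)
  \<comment> \<open>Taking \<open>M\<close> to be \<open>V\<close> and then the half-space, both
    distances equal the distance from \<open>x\<close> to \<open>proj V x\<close>.\<close>
  then show ?thesis
    using hilbert_dist_set_eq_proj[OF assms(2,3)] by (metis order_refl subsetD)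
qed

end
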